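(* Let $\Omega\subset\mathbb{R}^n$ be open, let $f\in C(\Omega\times\mathbb{R},\mathbb{R})$, and let $g\in C(\mathbb{R},\mathbb{R})$ be such that there exists $s_0\ge 0$ with $g\ge 0$ on $[s_0,\infty)$ and $g\le 0$ on $(-\infty,-s_0]$. Let $G(s)=\int_0^s g(\tau)\,d\tau$ and $\Phi_g(t)=\int_0^t \mathrm{e}^{G(s)}\,ds$ for $s,t\in\mathbb{R}$. Let $M:\Omega\times\mathbb{R}^n\times S_n(\mathbb{R})\to\mathbb{R}$, with associated natural gradient term $N$, satisfy the following two conditions: (i) there exists $\alpha\in\mathbb{R}$ such that $M(x,\lambda p,X)=|\lambda|^{\alpha}M(x,p,X)$ for all $\lambda\in\mathbb{R}\setminus\{0\}$ and all $(x,p,X)\in\Omega\times\mathbb{R}^n\times S_n(\mathbb{R})$; (ii) there exists $\beta\in\mathbb{N}\cup\{0\}$ such that $M(x,p,\gamma X+\sigma(p\otimes p))=\gamma^{\beta+1}M(x,p,X)+\sigma\gamma^{\beta}N(x,p,X)$ for all $\gamma\in\mathbb{R}\setminus\{0\}$, $\sigma\in\mathbb{R}$ and all $(x,p,X)\in\Omega\times\mathbb{R}^n\times S_n(\mathbb{R})$. Let $h(x,s)=\mathrm{e}^{(\alpha+\beta+1)G(\Phi_g^{-1}(s))}f(x,\Phi_g^{-1}(s))$ for $(x,s)\in\Omega\times\mathbb{R}$. If $v:\Omega\to\mathbb{R}$ is a viscosity solution of $$M(x,Dw,D^2w)+h(x,w)=0\quad\text{in }\Omega, \qquad (B)$$ then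 $u=\Phi_g^{-1}(v)$ is a viscosity solution of $$M(x,Dw,D^2w)+g(w)N(x,Dw,D^2w)+f(x,w)=0\quad\text{in }\Omega. \qquad (A)$$ Conversely, if $u\in C(\Omega)$ is a viscosity solution of (A), then $v=\Phi_g(u)$ is a viscosity solution of (B).
   Context: $S_n(\mathbb{R})$ denotes the set of real symmetric $n\times n$ matrices, and $p\otimes p$ is the matrix $[p_ip_j]$. Standing assumption: $M:\Omega\times\mathbb{R}^n\times S_n(\mathbb{R})\to\mathbb{R}$ is continuous and admits partial derivatives with respect to the entries $X_{ij}$ of $X=[X_{ij}]$. The matrix $\partial_X M(x,p,X)\in S_n(\mathbb{R})$ has $ij$ entry $\partial_X^{ij}M(x,p,X)=\frac{\partial}{\partial X_{ij}}M(x,p,X)$ if $p\ne 0$, and $\partial_X^{ij}M(x,0,X)=0$. The natural gradient term is $N(x,p,X)=\langle \partial_X M(x,p,X)p,p\rangle$ for all $(x,p,X)\in\Omega\times\mathbb{R}^n\times S_n(\mathbb{R})$. Under the assumption on $g$, $\Phi_g$ is a strictly increasing $C^2$-diffeomorphism of $\mathbb{R}$ onto $\mathbb{R}$, so $\Phi_g^{-1}:\mathbb{R}\to\mathbb{R}$ is defined. Viscosity solutions (no ellipticity is assumed): let $\mathcal{F}:\Omega\times\mathbb{R}\times\mathbb{R}^n\times S_n(\mathbb{R})\to\mathbb{R}$. A continuous function $u:\Omega\to\mathbb{R}$ is a viscosity subsolution of $\mathcal{F}(x,w,Dw,D^2w)=0$ in $\Omega$ if, whenever $\varphi\in C^2(\Omega)$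 is such that $u-\varphi$ has a local maximum at some $x_0\in\Omega$, one has $\mathcal{F}(x_0,u(x_0),D\varphi(x_0),D^2\varphi(x_0))\le 0$. It is a viscosity supersolution if, whenever $\varphi\in C^2(\Omega)$ is such that $u-\varphi$ has a local minimum at some $x_0\in\Omega$, one has $\mathcal{F}(x_0,u(x_0),D\varphi(x_0),D^2\varphi(x_0))\ge 0$. It is a viscosity solution if it is both a viscosity subsolution and a viscosity supersolution. For (A) and (B), $\mathcal{F}$ is the left-hand side of the equation as written. *)

theory Defs
  imports "HOL-Analysis.Analysis"
begin

definition sym_mats :: "(real^'n^'n) set" where
  "sym_mats = {X. transpose X = X}"

definition outer :: "real^'n \<Rightarrow> real^'n \<Rightarrow> real^'n^'n" where
  "outer p q = (\<chi> i j. p $ i * q $ j)"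

text \<open>
  Functions on symmetric matrices are total functions on \<^typ>\<open>real^'n^'n\<close> of which only the
  values on \<^const>\<open>sym_mats\<close> matter. The partial derivative with respect to the
  \<open>ij\<close> entry is taken along the symmetric part of the matrix unit \<open>E\<^sub>i\<^sub>j\<close>, so that it never
  leaves \<^const>\<open>sym_mats\<close>. Hence the matrix of partial derivatives is the gradient
  with respect to the inner product \<open>(X, Y) \<mapsto> (\<Sum>i j. X\<^sub>i\<^sub>j Y\<^sub>i\<^sub>j)\<close> of symmetric matrices; for example
  it is \<open>p \<otimes> p\<close> for the function \<open>X \<mapsto> \<langle>X p, p\<rangle>\<close>.
\<close>

definition sym_unit :: "'n \<Rightarrow> 'n \<Rightarrow> real^'n^'n" where
  "sym_unit i j = (1/2) *\<^sub>R (outer (axis i 1) (axis j 1) + outer (axis j 1) (axis i 1))"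

definition has_entry_partials ::
    "(real^'n) set \<Rightarrow> (real^'n \<Rightarrow> real^'n \<Rightarrow> real^'n^'n \<Rightarrow> real) \<Rightarrow> bool" where
  "has_entry_partials \<Omega> M \<longleftrightarrow>
     (\<forall>x\<in>\<Omega>. \<forall>p. \<forall>X\<in>sym_mats. \<forall>i j.
        (\<lambda>t. M x p (X + t *\<^sub>R sym_unit i j)) field_differentiable (at 0))"

definition partial_X ::
    "(real^'n \<Rightarrow> real^'n \<Rightarrow> real^'n^'n \<Rightarrow> real) \<Rightarrow> real^'n \<Rightarrow> real^'n \<Rightarrow> real^'n^'n \<Rightarrow> real^'n^'n" where
  "partial_X M x p X =
     (\<chi> i j. if p = 0 then 0 else deriv (\<lambda>t. M x p (X + t *\<^sub>R sym_unit i j)) 0)"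

definition natural_gradient_term ::
    "(real^'n \<Rightarrow> real^'n \<Rightarrow> real^'n^'n \<Rightarrow> real) \<Rightarrow> real^'n \<Rightarrow> real^'n \<Rightarrow> real^'n^'n \<Rightarrow> real" where
  "natural_gradient_term M x p X = (partial_X M x p X *v p) \<bullet> p"

definition grad :: "(real^'n \<Rightarrow> real) \<Rightarrow> real^'n \<Rightarrow> real^'n" where
  "grad \<phi> x = (\<chi> i. frechet_derivative \<phi> (at x) (axis i 1))"

definition hess :: "(real^'n \<Rightarrow> real) \<Rightarrow> real^'n \<Rightarrow> real^'n^'n" where
  "hess \<phi> x = jacobian (grad \<phi>) (at x)"

text \<open>Meant for open \<open>\<Omega>\<close>, since derivatives are taken in the full space.\<close>

definition C2_on :: "(real^'n) set \<Rightarrow> (real^'n \<Rightarrow> real) \<Rightarrow> bool" where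
  "C2_on \<Omega> \<phi> \<longleftrightarrow>
     (\<forall>x\<in>\<Omega>. \<phi> differentiable (at x)) \<and>
     (\<forall>x\<in>\<Omega>. grad \<phi> differentiable (at x)) \<and>
     continuous_on \<Omega> (hess \<phi>)"

definition viscosity_subsolution ::
    "(real^'n) set \<Rightarrow> (real^'n \<Rightarrow> real \<Rightarrow> real^'n \<Rightarrow> real^'n^'n \<Rightarrow> real) \<Rightarrow> (real^'n \<Rightarrow> real) \<Rightarrow> bool" where
  "viscosity_subsolution \<Omega> F u \<longleftrightarrow> continuous_on \<Omega> u \<and>
     (\<forall>\<phi> x0. C2_on \<Omega> \<phi> \<longrightarrow> x0 \<in> \<Omega> \<longrightarrow>
        (\<forall>\<^sub>F x in at x0 within \<Omega>. u x - \<phi> x \<le> u x0 - \<phi> x0) \<longrightarrow>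
        F x0 (u x0) (grad \<phi> x0) (hess \<phi> x0) \<le> 0)"

definition viscosity_supersolution ::
    "(real^'n) set \<Rightarrow> (real^'n \<Rightarrow> real \<Rightarrow> real^'n \<Rightarrow> real^'n^'n \<Rightarrow> real) \<Rightarrow> (real^'n \<Rightarrow> real) \<Rightarrow> bool" where
  "viscosity_supersolution \<Omega> F u \<longleftrightarrow> continuous_on \<Omega> u \<and>
     (\<forall>\<phi> x0. C2_on \<Omega> \<phi> \<longrightarrow> x0 \<in> \<Omega> \<longrightarrow>
        (\<forall>\<^sub>F x in at x0 within \<Omega>. u x - \<phi> x \<ge> u x0 - \<phi> x0) \<longrightarrow>
        F x0 (u x0) (grad \<phi> x0) (hess \<phi> x0) \<ge> 0)"

definition viscosity_solution ::
    "(real^'n) set \<Rightarrow> (real^'n \<Rightarrow> real \<Rightarrow> real^'n \<Rightarrow> real^'n^'n \<Rightarrow> real) \<Rightarrow> (real^'n \<Rightarrow> real) \<Rightarrow> bool" where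
  "viscosity_solution \<Omega> F u \<longleftrightarrow> viscosity_subsolution \<Omega> F u \<and> viscosity_supersolution \<Omega> F u"

text \<open>The interval integral is oriented: it changes sign for a negative upper limit.\<close>

definition prim :: "(real \<Rightarrow> real) \<Rightarrow> real \<Rightarrow> real" where
  "prim g s = (LBINT \<tau>=0..s. g \<tau>)"

definition Phi :: "(real \<Rightarrow> real) \<Rightarrow> real \<Rightarrow> real" where
  "Phi g t = (LBINT s=0..t. exp (prim g s))"

end

theory Submission
  imports Defs
begin

text \<open>
  If \<open>\<phi>\<close> is \<open>C\<^sup>2\<close> with gradient \<open>p\<close> and Hessian \<open>X\<close>, and \<open>E = exp (G \<phi>)\<close>, then \<open>\<Phi>\<^sub>g \<circ> \<phi>\<close> has gradient
  \<open>E p\<close> and Hessian \<open>E (X + g(\<phi>) p \<otimes> p)\<close>. Hypotheses (i) and (ii) with \<open>\<gamma> = E\<close> and \<open>\<sigma> = E g(\<phi>)\<close>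
  turn the left-hand side of (B) at \<open>\<Phi>\<^sub>g \<circ> \<phi>\<close> into the positive multiple \<open>E\<^bsup>\<alpha>+\<beta>+1\<^esup>\<close> of the left-hand
  side of (A) at \<open>\<phi>\<close>. Hence composing test functions with \<open>\<Phi>\<^sub>g\<close> or its inverse, both increasing
  and \<open>C\<^sup>2\<close>, carries each viscosity inequality of one equation into that of the other. The sign
  condition on \<open>g\<close> bounds \<open>G\<close> from below, so \<open>\<Phi>\<^sub>g\<close> is onto. Hypothesis (ii) speaks only of
  symmetric matrices, so the Hessian must be known to be symmetric.
\<close>

section \<open>Symmetry of second derivatives\<close>

text \<open>Mean value theorem along \<open>v\<close>, then the first-order expansion of
  \<open>D\<close> at \<open>a\<close>. The remainders at
  \<open>t *\<^sub>R u + s *\<^sub>R v\<close> and at \<open>s *\<^sub>R v\<close> are at most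
  \<open>e * t\<close> times \<open>norm u + norm v\<close> and \<open>norm v\<close>, which gives
  the constant \<open>norm u + 2 * norm v\<close>.\<close>

lemma second_difference_bound:
  fixes \<phi> :: "'a::real_inner \<Rightarrow> real"
  assumes "open S" "a \<in> S"
    and \<phi>: "\<And>x. x \<in> S \<Longrightarrow> (\<phi> has_derivative (\<lambda>h. D x \<bullet> h)) (at x)"
    and D: "(D has_derivative L) (at a)"
    and "e > 0"
  shows "\<forall>\<^sub>F t in at_right 0. \<bar>\<phi> (a + t *\<^sub>R u + t *\<^sub>R v) - \<phi> (a + t *\<^sub>R u) - \<phi> (a + t *\<^sub>R v) + \<phi> a
           - t\<^sup>2 * (L u \<bullet> v)\<bar> \<le> t\<^sup>2 * (e * ((norm u + 2 * norm v) * norm v))"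
proof -
  obtain r where r: "r > 0" "ball a r \<subseteq> S"
    using \<open>open S\<close> \<open>a \<in> S\<close> open_contains_ball by blast
  obtain d where d: "d > 0"
      "\<And>y. norm (y - a) < d \<Longrightarrow> norm (D y - D a - L (y - a)) \<le> e * norm (y - a)"
    using D \<open>e > 0\<close> unfolding has_derivative_at_alt by blast
  interpret L: bounded_linear L
    using D by (rule has_derivative_bounded_linear)
  \<comment> \<open>For \<open>t < b\<close> the whole parallelogram spanned by
    \<open>t *\<^sub>R u\<close> and \<open>t *\<^sub>R v\<close> at \<open>a\<close> lies within
    \<open>r\<close>, hence in \<open>S\<close>, and within \<open>d\<close>, where the expansion of
    \<open>D\<close> holds. The summand 1 keeps the denominator positive when both vectors
    vanish.\<close>
  define b where "b = min r d / (norm u + norm v + 1)"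
  have K: "norm u + norm v + 1 > 0"
    by (smt (verit) norm_ge_zero)
  have "b > 0"
    using K r d by (simp add: b_def)
  moreover have "\<bar>\<phi> (a + t *\<^sub>R u + t *\<^sub>R v) - \<phi> (a + t *\<^sub>R u) - \<phi> (a + t *\<^sub>R v) + \<phi> a
           - t\<^sup>2 * (L u \<bullet> v)\<bar> \<le> t\<^sup>2 * (e * ((norm u + 2 * norm v) * norm v))"
    if t: "0 < t" "t < b" for t
  proof -
    have tK: "t * (norm u + norm v + 1) < min r d"
      using t K by (simp add: b_def pos_less_divide_eq)
    have near: "norm (\<sigma> *\<^sub>R u + s *\<^sub>R v) < min r d" if "0 \<le> s" "s \<le> t" "0 \<le> \<sigma>" "\<sigma> \<le> t" for s \<sigma>
    proof -
      have "norm (\<sigma> *\<^sub>R u + s *\<^sub>R v) \<le> \<sigma> * norm u + s * norm v"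
        using that norm_triangle_ineq[of "\<sigma> *\<^sub>R u" "s *\<^sub>R v"] by simp
      also have "\<dots> \<le> t * norm u + t * norm v"
        using that by (intro add_mono mult_right_mono) auto
      also have "\<dots> < min r d"
        using tK t by (simp add: algebra_simps)
      finally show ?thesis .
    qed
    have inS: "a + \<sigma> *\<^sub>R u + s *\<^sub>R v \<in> S" if "0 \<le> s" "s \<le> t" "0 \<le> \<sigma>" "\<sigma> \<le> t" for s \<sigma>
    proof -
      have "a + \<sigma> *\<^sub>R u + s *\<^sub>R v \<in> ball a r"
        using near[OF that] by (simp add: dist_norm norm_minus_commute add.assoc) (simp add: add.commute)
      then show ?thesis using r by blast
    qed
    \<comment> \<open>The second difference is the increment of \<open>q\<close> from 0 to
      \<open>t\<close>, so a single mean value step in the direction \<open>v\<close> reduces it to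
      values of \<open>D\<close>.\<close>
    define q where "q s = \<phi> (a + t *\<^sub>R u + s *\<^sub>R v) - \<phi> (a + s *\<^sub>R v)" for s
    have line: "((\<lambda>s. \<phi> (c + s *\<^sub>R v)) has_real_derivative D (c + s *\<^sub>R v) \<bullet> v) (at s)"
      if "c + s *\<^sub>R v \<in> S" for c s
    proof -
      have "((\<lambda>s. c + s *\<^sub>R v) has_derivative (\<lambda>h. h *\<^sub>R v)) (at s)"
        by (auto intro!: derivative_eq_intros)
      from has_derivative_compose[OF this \<phi>[OF that]] show ?thesis
        by (simp add: has_field_derivative_def mult_commute_abs)
    qed
    have q': "(q has_real_derivative (D (a + t *\<^sub>R u + s *\<^sub>R v) \<bullet> v - D (a + s *\<^sub>R v) \<bullet> v)) (at s)"
      if "0 \<le> s" "s \<le> t" for s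
      unfolding q_def using t that inS[of s t] inS[of s 0] by (intro DERIV_diff line) auto
    obtain s where s: "0 < s" "s < t"
      "q t - q 0 = (t - 0) * (D (a + t *\<^sub>R u + s *\<^sub>R v) \<bullet> v - D (a + s *\<^sub>R v) \<bullet> v)"
      using MVT2[OF t(1) q'] by blast
    \<comment> \<open>The remainder of the linear approximation of \<open>D\<close> at
      \<open>a\<close>.\<close>
    define E where "E w = D (a + w) - D a - L w" for w
    have E: "norm (E w) \<le> e * norm w" if "norm w < d" for w
      using d(2)[of "a + w"] that by (simp add: E_def)
    have n1: "norm (t *\<^sub>R u + s *\<^sub>R v) \<le> t * norm u + t * norm v"
    proof -
      have "norm (t *\<^sub>R u + s *\<^sub>R v) \<le> t * norm u + s * norm v"
        using s t norm_triangle_ineq[of "t *\<^sub>R u" "s *\<^sub>R v"] by simp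
      also have "\<dots> \<le> t * norm u + t * norm v"
        using s by (intro add_mono mult_right_mono) auto
      finally show ?thesis .
    qed
    have n2: "norm (s *\<^sub>R v) \<le> t * norm v"
      using s by (auto intro: mult_right_mono)
    have "norm (E (t *\<^sub>R u + s *\<^sub>R v) - E (s *\<^sub>R v))
        \<le> e * norm (t *\<^sub>R u + s *\<^sub>R v) + e * norm (s *\<^sub>R v)"
      using near[of s t] near[of s 0] s t
      by (intro order_trans[OF norm_triangle_ineq4] add_mono E) auto
    also have "\<dots> \<le> e * (t * norm u + t * norm v) + e * (t * norm v)"
      using n1 n2 \<open>e > 0\<close> by (intro add_mono mult_left_mono) auto
    also have "\<dots> = t * (e * (norm u + 2 * norm v))"
      by (simp add: algebra_simps)
    finally have Eb: "norm (E (t *\<^sub>R u + s *\<^sub>R v) - E (s *\<^sub>R v)) \<le> t * (e * (norm u + 2 * norm v))" .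
    have "\<phi> (a + t *\<^sub>R u + t *\<^sub>R v) - \<phi> (a + t *\<^sub>R u) - \<phi> (a + t *\<^sub>R v) + \<phi> a - t\<^sup>2 * (L u \<bullet> v)
        = q t - q 0 - t\<^sup>2 * (L u \<bullet> v)"
      by (simp add: q_def)
    \<comment> \<open>The unknown intermediate point \<open>s\<close> cancels from the linear part,
      since \<open>L (t *\<^sub>R u + s *\<^sub>R v) - L (s *\<^sub>R v) = t *\<^sub>R L u\<close>;
      only the remainders still depend on it.\<close>
    also have "\<dots> = t * ((E (t *\<^sub>R u + s *\<^sub>R v) - E (s *\<^sub>R v)) \<bullet> v)"
      by (simp add: s(3) E_def L.add L.scaleR inner_simps algebra_simps power2_eq_square)
    finally have "\<bar>\<phi> (a + t *\<^sub>R u + t *\<^sub>R v) - \<phi> (a + t *\<^sub>R u) - \<phi> (a + t *\<^sub>R v) + \<phi> a - t\<^sup>2 * (L u \<bullet> v)\<bar>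
        = t * \<bar>(E (t *\<^sub>R u + s *\<^sub>R v) - E (s *\<^sub>R v)) \<bullet> v\<bar>"
      using t by (simp add: abs_mult)
    also have "\<dots> \<le> t * (norm (E (t *\<^sub>R u + s *\<^sub>R v) - E (s *\<^sub>R v)) * norm v)"
      using t by (intro mult_left_mono Cauchy_Schwarz_ineq2) auto
    also have "\<dots> \<le> t * (t * (e * (norm u + 2 * norm v)) * norm v)"
      using t Eb by (intro mult_left_mono mult_right_mono) auto
    finally show ?thesis
      by (simp add: power2_eq_square algebra_simps)
  qed
  ultimately show ?thesis
    unfolding eventually_at_right_field by blast
qed

text \<open>The second difference does not change when \<open>u\<close> and \<open>v\<close> are
  swapped, yet it is close to both \<open>t\<^sup>2 * (L u \<bullet> v)\<close> and
  \<open>t\<^sup>2 * (L v \<bullet> u)\<close>. Dividing by \<open>t\<^sup>2\<close> and letting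
  \<open>e\<close> tend to 0 identifies the two.\<close>

lemma second_derivative_symmetric:
  fixes \<phi> :: "'a::real_inner \<Rightarrow> real"
  assumes "open S" "a \<in> S"
    and \<phi>: "\<And>x. x \<in> S \<Longrightarrow> (\<phi> has_derivative (\<lambda>h. D x \<bullet> h)) (at x)"
    and D: "(D has_derivative L) (at a)"
  shows "L u \<bullet> v = L v \<bullet> u"
proof -
  define C where "C = (norm u + 2 * norm v) * norm v + (norm v + 2 * norm u) * norm u"
  have C: "C \<ge> 0" by (simp add: C_def)
  have bound: "\<bar>L u \<bullet> v - L v \<bullet> u\<bar> \<le> e * C" if "e > 0" for e
  proof -
    have pos: "\<forall>\<^sub>F t::real in at_right 0. t > 0"
      by (simp add: eventually_at_right_less)
    have diff: "\<forall>\<^sub>F t in at_right 0. \<bar>\<phi> (a + t *\<^sub>R u + t *\<^sub>R v) - \<phi> (a + t *\<^sub>R u) - \<phi> (a + t *\<^sub>R v)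
        + \<phi> a - t\<^sup>2 * (L u \<bullet> v)\<bar> \<le> t\<^sup>2 * (e * ((norm u + 2 * norm v) * norm v))" for u v
      by (rule second_difference_bound[OF assms(1,2) \<phi> D that])
    from pos diff[of u v] diff[of v u]
    have "\<forall>\<^sub>F t::real in at_right 0. \<bar>L u \<bullet> v - L v \<bullet> u\<bar> \<le> e * C"
    proof eventually_elim
      case (elim t)
      have c: "a + t *\<^sub>R v + t *\<^sub>R u = a + t *\<^sub>R u + t *\<^sub>R v" by simp
      have "\<bar>t\<^sup>2 * (L u \<bullet> v) - t\<^sup>2 * (L v \<bullet> u)\<bar> \<le>
         t\<^sup>2 * (e * ((norm u + 2 * norm v) * norm v)) + t\<^sup>2 * (e * ((norm v + 2 * norm u) * norm u))"
        using elim(2,3) unfolding c by linarith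
      also have "\<dots> = t\<^sup>2 * (e * C)"
        by (simp add: C_def algebra_simps)
      finally have "t\<^sup>2 * \<bar>L u \<bullet> v - L v \<bullet> u\<bar> \<le> t\<^sup>2 * (e * C)"
        by (simp add: abs_mult flip: right_diff_distrib)
      then show ?case
        using elim(1) by simp
    qed
    \<comment> \<open>The inequality no longer contains \<open>t\<close>, and
      \<open>at_right 0\<close> is a nontrivial filter, so holding eventually means holding.\<close>
    then show ?thesis
      by (simp add: eventually_const_iff)
  qed
  have "\<bar>L u \<bullet> v - L v \<bullet> u\<bar> \<le> 0 + e" if "e > 0" for e
  proof -
    \<comment> \<open>Dividing by \<open>C + 1\<close> instead of \<open>C\<close> covers the case
      \<open>C = 0\<close>.\<close>
    have "\<bar>L u \<bullet> v - L v \<bullet> u\<bar> \<le> e / (C + 1) * C"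
      using bound[of "e / (C + 1)"] that C by simp
    also have "\<dots> \<le> e"
      using that C by (simp add: field_simps)
    finally show ?thesis by simp
  qed
  then have "\<bar>L u \<bullet> v - L v \<bullet> u\<bar> \<le> 0"
    by (rule field_le_epsilon)
  then show ?thesis by simp
qed

section \<open>Gradients, Hessians and their chain rule\<close>

lemma grad_eqI:
  assumes "(\<phi> has_derivative (\<lambda>h. p \<bullet> h)) (at x)"
  shows "grad \<phi> x = p"
  by (simp add: grad_def vec_eq_iff inner_axis flip: frechet_derivative_at[OF assms])

lemma has_derivative_grad:
  fixes \<phi> :: "real^'n \<Rightarrow> real"
  assumes "\<phi> differentiable (at x)"
  shows "(\<phi> has_derivative (\<lambda>h. grad \<phi> x \<bullet> h)) (at x)"
proof -
  let ?D = "frechet_derivative \<phi> (at x)"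
  have D: "(\<phi> has_derivative ?D) (at x)"
    using assms frechet_derivative_works by blast
  interpret D: bounded_linear ?D
    using D by (rule has_derivative_bounded_linear)
  have "?D h = grad \<phi> x \<bullet> h" for h
  proof -
    have "?D h = ?D (\<Sum>i\<in>UNIV. h $ i *\<^sub>R axis i 1)"
      by (metis basis_expansion scalar_mult_eq_scaleR)
    also have "\<dots> = grad \<phi> x \<bullet> h"
      by (simp add: D.sum D.scaleR grad_def inner_vec_def mult.commute)
    finally show ?thesis .
  qed
  then have "?D = (\<lambda>h. grad \<phi> x \<bullet> h)" by auto
  with D show ?thesis by (simp only:)
qed

lemma hess_eqI:
  assumes "(grad \<phi> has_derivative (\<lambda>h. A *v h)) (at x)"
  shows "hess \<phi> x = A"
  by (simp add: hess_def jacobian_def flip: frechet_derivative_at[OF assms])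

lemma has_derivative_hess:
  assumes "grad \<phi> differentiable (at x)"
  shows "(grad \<phi> has_derivative (\<lambda>h. hess \<phi> x *v h)) (at x)"
  using assms by (simp add: hess_def jacobian_works)

lemma hess_in_sym_mats:
  assumes "open S" "C2_on S \<phi>" "x \<in> S"
  shows "hess \<phi> x \<in> sym_mats"
proof -
  have "(hess \<phi> x *v u) \<bullet> v = (hess \<phi> x *v v) \<bullet> u" for u v
    using assms unfolding C2_on_def
    by (intro second_derivative_symmetric[of S x \<phi> "grad \<phi>"] has_derivative_grad has_derivative_hess) auto
  \<comment> \<open>Pairing with coordinate vectors reads off the entries of the Hessian.\<close>
  from this[of "axis j 1" "axis i 1" for i j] show ?thesis
    by (simp add: sym_mats_def transpose_def vec_eq_iff inner_axis matrix_vector_mul_component)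
qed

lemma outer_scaleR: "outer (a *\<^sub>R p) (b *\<^sub>R q) = (a * b) *\<^sub>R outer p q"
  by (simp add: outer_def vec_eq_iff)

lemma outer_mult_vec: "outer p q *v h = (q \<bullet> h) *\<^sub>R p"
  by (simp add: outer_def vec_eq_iff matrix_vector_mult_def inner_vec_def sum_distrib_left mult_ac)

lemma sym_mats_combine:
  assumes "X \<in> sym_mats"
  shows "a *\<^sub>R X + b *\<^sub>R outer p p \<in> sym_mats"
  using assms by (simp add: sym_mats_def transpose_def outer_def vec_eq_iff mult.commute)

text \<open>The Hessian formula is the product rule for
  \<open>F' (\<phi> x) *\<^sub>R grad \<phi> x\<close>: differentiating the scalar factor produces
  the rank-one term.\<close>

lemma C2_on_compose:
  fixes F F' F'' :: "real \<Rightarrow> real"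
  assumes "open S" and \<phi>: "C2_on S \<phi>"
    and F: "\<And>t. (F has_real_derivative F' t) (at t)"
    and F': "\<And>t. (F' has_real_derivative F'' t) (at t)"
    and F'': "continuous_on UNIV F''"
  shows "C2_on S (\<lambda>x. F (\<phi> x))"
    and "x \<in> S \<Longrightarrow> grad (\<lambda>x. F (\<phi> x)) x = F' (\<phi> x) *\<^sub>R grad \<phi> x"
    and "x \<in> S \<Longrightarrow> hess (\<lambda>x. F (\<phi> x)) x
           = F' (\<phi> x) *\<^sub>R hess \<phi> x + F'' (\<phi> x) *\<^sub>R outer (grad \<phi> x) (grad \<phi> x)"
proof -
  let ?\<psi> = "\<lambda>x. F (\<phi> x)"
  let ?H = "\<lambda>x. F' (\<phi> x) *\<^sub>R hess \<phi> x + F'' (\<phi> x) *\<^sub>R outer (grad \<phi> x) (grad \<phi> x)"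
  have d1: "(\<phi> has_derivative (\<lambda>h. grad \<phi> x \<bullet> h)) (at x)" if "x \<in> S" for x
    using \<phi> that by (simp add: C2_on_def has_derivative_grad)
  have d2: "(grad \<phi> has_derivative (\<lambda>h. hess \<phi> x *v h)) (at x)" if "x \<in> S" for x
    using \<phi> that by (simp add: C2_on_def has_derivative_hess)
  have e1: "(?\<psi> has_derivative (\<lambda>h. (F' (\<phi> x) *\<^sub>R grad \<phi> x) \<bullet> h)) (at x)" if "x \<in> S" for x
    using has_derivative_compose[OF d1[OF that] F[unfolded has_field_derivative_def]] by simp
  have g: "grad ?\<psi> x = F' (\<phi> x) *\<^sub>R grad \<phi> x" if "x \<in> S" for x
    using e1[OF that] by (rule grad_eqI)
  have e2: "(grad ?\<psi> has_derivative (\<lambda>h. ?H x *v h)) (at x)" if "x \<in> S" for x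
  proof -
    have "((\<lambda>x. F' (\<phi> x) *\<^sub>R grad \<phi> x) has_derivative
        (\<lambda>h. F' (\<phi> x) *\<^sub>R (hess \<phi> x *v h) + (F'' (\<phi> x) * (grad \<phi> x \<bullet> h)) *\<^sub>R grad \<phi> x)) (at x)"
      by (rule has_derivative_scaleR[OF
            has_derivative_compose[OF d1[OF that] F'[unfolded has_field_derivative_def]] d2[OF that]])
    then have "((\<lambda>x. F' (\<phi> x) *\<^sub>R grad \<phi> x) has_derivative (\<lambda>h. ?H x *v h)) (at x)"
      by (simp add: matrix_vector_mult_add_rdistrib outer_mult_vec flip: scaleR_matrix_vector_assoc)
    \<comment> \<open>The gradient formula is known on \<open>S\<close> only; as \<open>S\<close> is
      open, this determines the derivative at \<open>x\<close>.\<close>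
    then show ?thesis
      by (rule has_derivative_transform_within_open[OF _ \<open>open S\<close> that]) (simp add: g)
  qed
  have H: "hess ?\<psi> x = ?H x" if "x \<in> S" for x
    using e2[OF that] by (rule hess_eqI)
  have c\<phi>: "continuous_on S \<phi>" and cg: "continuous_on S (grad \<phi>)"
    using has_derivative_continuous_on[of S \<phi> "\<lambda>x h. grad \<phi> x \<bullet> h"]
      has_derivative_continuous_on[of S "grad \<phi>" "\<lambda>x h. hess \<phi> x *v h"]
      d1 d2 has_derivative_at_withinI by blast+
  have "continuous_on S (\<lambda>x. F' (\<phi> x))"
    by (rule continuous_on_compose2[OF _ c\<phi>, of UNIV])
       (use F' in \<open>auto intro: DERIV_continuous_on has_field_derivative_at_within\<close>)
  moreover have "continuous_on S (\<lambda>x. F'' (\<phi> x))"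
    by (rule continuous_on_compose2[OF F'' c\<phi>]) auto
  moreover have "continuous_on S (\<lambda>x. outer (grad \<phi> x) (grad \<phi> x))"
    unfolding outer_def by (intro continuous_intros cg)
  ultimately have "continuous_on S ?H"
    using \<phi> by (intro continuous_intros) (auto simp: C2_on_def)
  then have "continuous_on S (hess ?\<psi>)"
    by (simp add: H cong: continuous_on_cong)
  with e1 e2 show "C2_on S ?\<psi>"
    unfolding C2_on_def differentiable_def by blast
  show "x \<in> S \<Longrightarrow> grad ?\<psi> x = F' (\<phi> x) *\<^sub>R grad \<phi> x" by (rule g)
  show "x \<in> S \<Longrightarrow> hess ?\<psi> x = ?H x" by (rule H)
qed

section \<open>Viscosity solutions under a monotone change of the unknown\<close>

text \<open>Translating a test function so that it touches \<open>u\<close> at the point under consideration makes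
  \<open>F\<close> preserve the contact, so \<open>F \<circ> \<phi>\<close> is a test function for \<open>F \<circ> u\<close>.\<close>

lemma viscosity_solution_change_of_variable:
  fixes F F' F'' :: "real \<Rightarrow> real" and \<Omega> :: "(real^'n) set"
  assumes "open \<Omega>" and "mono F"
    and F: "\<And>t. (F has_real_derivative F' t) (at t)"
    and F': "\<And>t. (F' has_real_derivative F'' t) (at t)"
    and F'': "continuous_on UNIV F''"
    and rel: "\<And>x s p X. x \<in> \<Omega> \<Longrightarrow> X \<in> sym_mats \<Longrightarrow>
       \<exists>c>0. \<G> x (F s) (F' s *\<^sub>R p) (F' s *\<^sub>R X + F'' s *\<^sub>R outer p p) = c * \<F> x s p X"
    and u: "continuous_on \<Omega> u"
    and sol: "viscosity_solution \<Omega> \<G> (\<lambda>x. F (u x))"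
  shows "viscosity_solution \<Omega> \<F> u"
proof -
  \<comment> \<open>One \<open>\<psi>\<close> serves both halves of the definition. The contact
    statements are pointwise implications, so they carry over to local extrema without a choice of
    neighbourhood.\<close>
  have main: "\<exists>\<psi> c. C2_on \<Omega> \<psi> \<and> c > 0 \<and>
      \<G> x0 (F (u x0)) (grad \<psi> x0) (hess \<psi> x0) = c * \<F> x0 (u x0) (grad \<phi> x0) (hess \<phi> x0) \<and>
      (\<forall>x. u x - \<phi> x \<le> u x0 - \<phi> x0 \<longrightarrow> F (u x) - \<psi> x \<le> F (u x0) - \<psi> x0) \<and>
      (\<forall>x. u x - \<phi> x \<ge> u x0 - \<phi> x0 \<longrightarrow> F (u x) - \<psi> x \<ge> F (u x0) - \<psi> x0)"
    if \<phi>: "C2_on \<Omega> \<phi>" and x0: "x0 \<in> \<Omega>" for \<phi> x0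
  proof -
    define \<theta> where "\<theta> x = \<phi> x + (u x0 - \<phi> x0)" for x
    have translate: "((\<lambda>t. t + (u x0 - \<phi> x0)) has_real_derivative 1) (at t)" for t
      by (auto intro!: derivative_eq_intros)
    have "((\<lambda>_. 1) has_real_derivative 0) (at t)" "continuous_on UNIV (\<lambda>_::real. 0::real)" for t :: real
      by auto
    \<comment> \<open>A translation is itself a composition, with first derivative 1 and second
      derivative 0, so \<open>\<theta>\<close> inherits the regularity, gradient and Hessian of
      \<open>\<phi>\<close>.\<close>
    note C2_on_compose[OF \<open>open \<Omega>\<close> \<phi> translate this]
    then have \<theta>: "C2_on \<Omega> \<theta>" "grad \<theta> x0 = grad \<phi> x0" "hess \<theta> x0 = hess \<phi> x0"
      using x0 by (auto simp: \<theta>_def[abs_def])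
    have [simp]: "\<theta> x0 = u x0" by (simp add: \<theta>_def)
    note \<psi> = C2_on_compose[OF \<open>open \<Omega>\<close> \<theta>(1) F F' F'']
    obtain c where "c > 0" "\<G> x0 (F (u x0)) (grad (\<lambda>x. F (\<theta> x)) x0) (hess (\<lambda>x. F (\<theta> x)) x0)
        = c * \<F> x0 (u x0) (grad \<phi> x0) (hess \<phi> x0)"
      using rel[OF x0 hess_in_sym_mats[OF \<open>open \<Omega>\<close> \<theta>(1) x0], of "u x0" "grad \<theta> x0"]
      by (auto simp: \<psi>(2,3)[OF x0] \<theta>(2,3))
    \<comment> \<open>The premise says \<open>u x \<le> \<theta> x\<close>; monotonicity of
      \<open>F\<close> makes the left-hand side nonpositive, and the right-hand side is 0 by contact
      at \<open>x0\<close>.\<close>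
    moreover have "F (u x) - F (\<theta> x) \<le> F (u x0) - F (\<theta> x0)" if "u x - \<phi> x \<le> u x0 - \<phi> x0" for x
      using that monoD[OF \<open>mono F\<close>, of "u x" "\<theta> x"] by (simp add: \<theta>_def)
    moreover have "F (u x) - F (\<theta> x) \<ge> F (u x0) - F (\<theta> x0)" if "u x - \<phi> x \<ge> u x0 - \<phi> x0" for x
      using that monoD[OF \<open>mono F\<close>, of "\<theta> x" "u x"] by (simp add: \<theta>_def)
    ultimately show ?thesis
      using \<psi>(1) by blast
  qed
  have "\<F> x0 (u x0) (grad \<phi> x0) (hess \<phi> x0) \<le> 0"
    if \<phi>: "C2_on \<Omega> \<phi>" "x0 \<in> \<Omega>" "\<forall>\<^sub>F x in at x0 within \<Omega>. u x - \<phi> x \<le> u x0 - \<phi> x0" for \<phi> x0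
  proof -
    from main[OF \<phi>(1,2)] obtain \<psi> c where *: "C2_on \<Omega> \<psi>" "c > 0"
      "\<G> x0 (F (u x0)) (grad \<psi> x0) (hess \<psi> x0) = c * \<F> x0 (u x0) (grad \<phi> x0) (hess \<phi> x0)"
      "\<And>x. u x - \<phi> x \<le> u x0 - \<phi> x0 \<Longrightarrow> F (u x) - \<psi> x \<le> F (u x0) - \<psi> x0" by blast
    have "\<forall>\<^sub>F x in at x0 within \<Omega>. F (u x) - \<psi> x \<le> F (u x0) - \<psi> x0"
      using \<phi>(3) by (rule eventually_mono) (rule *(4))
    then have "\<G> x0 (F (u x0)) (grad \<psi> x0) (hess \<psi> x0) \<le> 0"
      using sol *(1) \<phi>(2) unfolding viscosity_solution_def viscosity_subsolution_def by blast
    with * show ?thesis by (simp add: mult_le_0_iff)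
  qed
  moreover have "\<F> x0 (u x0) (grad \<phi> x0) (hess \<phi> x0) \<ge> 0"
    if \<phi>: "C2_on \<Omega> \<phi>" "x0 \<in> \<Omega>" "\<forall>\<^sub>F x in at x0 within \<Omega>. u x - \<phi> x \<ge> u x0 - \<phi> x0" for \<phi> x0
  proof -
    from main[OF \<phi>(1,2)] obtain \<psi> c where *: "C2_on \<Omega> \<psi>" "c > 0"
      "\<G> x0 (F (u x0)) (grad \<psi> x0) (hess \<psi> x0) = c * \<F> x0 (u x0) (grad \<phi> x0) (hess \<phi> x0)"
      "\<And>x. u x - \<phi> x \<ge> u x0 - \<phi> x0 \<Longrightarrow> F (u x) - \<psi> x \<ge> F (u x0) - \<psi> x0" by blast
    have "\<forall>\<^sub>F x in at x0 within \<Omega>. F (u x) - \<psi> x \<ge> F (u x0) - \<psi> x0"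
      using \<phi>(3) by (rule eventually_mono) (rule *(4))
    then have "\<G> x0 (F (u x0)) (grad \<psi> x0) (hess \<psi> x0) \<ge> 0"
      using sol *(1) \<phi>(2) unfolding viscosity_solution_def viscosity_supersolution_def by blast
    with * show ?thesis by (simp add: zero_le_mult_iff)
  qed
  ultimately show ?thesis
    using u unfolding viscosity_solution_def viscosity_subsolution_def viscosity_supersolution_def
    by blast
qed

section \<open>The functions G and Phi_g and the inverse of Phi_g\<close>

lemma prim_has_real_derivative:
  assumes "continuous_on UNIV g"
  shows "(prim g has_real_derivative g t) (at t)"
proof -
  \<comment> \<open>The margin 1 puts both 0 and \<open>t\<close> in the interior of the interval,
    so the derivative within it is the full derivative.\<close>
  let ?a = "min 0 t - 1" and ?b = "max 0 t + 1"
  have "((\<lambda>u. LBINT y=0..u. g y) has_vector_derivative g t) (at t within {?a..?b})"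
    unfolding zero_ereal_def
    by (rule interval_integral_FTC2)
       (use assms in \<open>auto intro: continuous_on_subset\<close>)
  moreover have "at t within {?a..?b} = at t"
    by (rule at_within_interior) (auto simp: min_def max_def)
  ultimately show ?thesis
    by (simp add: prim_def[abs_def] has_real_derivative_iff_has_vector_derivative)
qed

text \<open>Lets the fundamental theorem, proved for \<open>prim\<close>, be applied a second time
  to obtain the derivative of \<open>Phi\<close>.\<close>

lemma Phi_conv_prim: "Phi g = prim (\<lambda>s. exp (prim g s))"
  by (simp add: fun_eq_iff Phi_def prim_def)

lemma continuous_on_prim:
  assumes "continuous_on UNIV g"
  shows "continuous_on UNIV (prim g)"
  using prim_has_real_derivative[OF assms] by (rule DERIV_continuous_on)

lemma Phi_has_real_derivative:
  assumes "continuous_on UNIV g"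
  shows "(Phi g has_real_derivative exp (prim g t)) (at t)"
  unfolding Phi_conv_prim
  by (intro prim_has_real_derivative continuous_intros continuous_on_prim assms)

lemma continuous_on_Phi:
  assumes "continuous_on UNIV g"
  shows "continuous_on UNIV (Phi g)"
  using Phi_has_real_derivative[OF assms] by (rule DERIV_continuous_on)

lemma strict_mono_Phi:
  assumes "continuous_on UNIV g"
  shows "strict_mono (Phi g)"
  by (rule strict_monoI, rule DERIV_pos_imp_increasing)
     (use Phi_has_real_derivative[OF assms] in \<open>auto intro!: exI\<close>)

text \<open>G attains a minimum on the compact interval from \<open>-s0\<close> to
  \<open>s0\<close>, and the signs of \<open>g\<close> make it nondecreasing to the right of that
  interval and nonincreasing to the left.\<close>

lemma prim_bounded_below:
  assumes g: "continuous_on UNIV g" and "s0 \<ge> 0"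
    and nonneg: "\<And>s. s \<ge> s0 \<Longrightarrow> g s \<ge> 0" and nonpos: "\<And>s. s \<le> - s0 \<Longrightarrow> g s \<le> 0"
  obtains m where "\<And>s. m \<le> prim g s"
proof -
  have "\<exists>m. \<forall>s\<in>{-s0..s0}. m \<le> prim g s"
    using continuous_attains_inf[of "{-s0..s0}" "prim g"] continuous_on_prim[OF g] \<open>s0 \<ge> 0\<close>
    by (auto intro: continuous_on_subset)
  then obtain m where "\<forall>s\<in>{-s0..s0}. m \<le> prim g s" ..
  then have m: "m \<le> prim g s" if "- s0 \<le> s" "s \<le> s0" for s
    using that by simp
  have "m \<le> prim g s" for s
  proof -
    consider "s < - s0" | "- s0 \<le> s" "s \<le> s0" | "s0 < s" by linarith
    then show ?thesis
    proof cases
      case 1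
      have "prim g (- s0) \<le> prim g s"
      proof (rule DERIV_nonpos_imp_nonincreasing[OF less_imp_le[OF 1]])
        fix r assume "r \<le> - s0"
        then show "\<exists>y. (prim g has_real_derivative y) (at r) \<and> y \<le> 0"
          using prim_has_real_derivative[OF g] nonpos by blast
      qed
      then show ?thesis using m[of "- s0"] \<open>s0 \<ge> 0\<close> by simp
    next
      case 2
      then show ?thesis by (rule m)
    next
      case 3
      have "prim g s0 \<le> prim g s"
      proof (rule DERIV_nonneg_imp_nondecreasing[OF less_imp_le[OF 3]])
        fix r assume "s0 \<le> r"
        then show "\<exists>y. (prim g has_real_derivative y) (at r) \<and> 0 \<le> y"
          using prim_has_real_derivative[OF g] nonneg by blast
      qed
      then show ?thesis using m[of s0] \<open>s0 \<ge> 0\<close> by simp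
    qed
  qed
  then show thesis by (rule that)
qed

text \<open>The derivative \<open>exp (prim g t)\<close> is at least \<open>exp m\<close>, so
  \<open>Phi g\<close> grows at least linearly in both directions and the intermediate value theorem
  applies.\<close>

lemma surj_Phi:
  assumes g: "continuous_on UNIV g" and m: "\<And>s. m \<le> prim g s"
  shows "surj (Phi g)"
proof -
  have mono: "mono (\<lambda>t. Phi g t - exp m * t)"
  proof (rule monoI)
    fix x y :: real assume "x \<le> y"
    then show "Phi g x - exp m * x \<le> Phi g y - exp m * y"
    proof (rule DERIV_nonneg_imp_nondecreasing)
      fix t
      have "((\<lambda>t. Phi g t - exp m * t) has_real_derivative exp (prim g t) - exp m) (at t)"
        by (auto intro!: derivative_eq_intros Phi_has_real_derivative g)
      with m[of t] show "\<exists>d. ((\<lambda>t. Phi g t - exp m * t) has_real_derivative d) (at t) \<and> 0 \<le> d"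
        by auto
    qed
  qed
  have "\<exists>t. Phi g t = y" for y
  proof -
    \<comment> \<open>The distance at which growth with slope \<open>exp m\<close> from
      \<open>Phi g 0\<close> is certain to have reached \<open>y\<close>.\<close>
    define b where "b = \<bar>y - Phi g 0\<bar> / exp m"
    have "b \<ge> 0" and eb: "exp m * b = \<bar>y - Phi g 0\<bar>" by (simp_all add: b_def)
    have "y \<le> Phi g b" "Phi g (- b) \<le> y"
      using monoD[OF mono, of 0 b] monoD[OF mono, of "- b" 0] \<open>b \<ge> 0\<close> eb by auto
    moreover have "continuous_on {- b..b} (Phi g)"
      using continuous_on_Phi[OF g] by (rule continuous_on_subset) simp
    ultimately show ?thesis
      using IVT'[of "Phi g" "- b" y b] \<open>b \<ge> 0\<close> by auto
  qed
  then show ?thesis by (metis surjI)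
qed

text \<open>A monotone function onto the line cannot jump. Continuity of the inverse is what the
  inverse function rule for derivatives requires beforehand.\<close>

lemma isCont_inv_strict_mono:
  fixes F :: "real \<Rightarrow> real"
  assumes "strict_mono F" "surj F"
  shows "isCont (inv F) y"
proof -
  have "strict_mono (inv F)"
    using assms by (metis strict_mono_inv_on_range)
  moreover have "surj (inv F)"
    using assms by (simp add: strict_mono_imp_inj_on inj_imp_surj_inv)
  ultimately have "continuous_on UNIV (inv F)"
    by (intro continuous_onI_mono) (auto simp: strict_mono_less_eq)
  then show ?thesis
    by (simp add: continuous_on_eq_continuous_at)
qed

section \<open>Equivalence of (A) and (B)\<close>

theorem theorem2:
  fixes \<Omega> :: "(real^'n) set"
    and f :: "real^'n \<Rightarrow> real \<Rightarrow> real"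
    and g :: "real \<Rightarrow> real"
    and M :: "real^'n \<Rightarrow> real^'n \<Rightarrow> real^'n^'n \<Rightarrow> real"
    and \<alpha> :: real and \<beta> :: nat
    and N :: "real^'n \<Rightarrow> real^'n \<Rightarrow> real^'n^'n \<Rightarrow> real"
    and h :: "real^'n \<Rightarrow> real \<Rightarrow> real"
  assumes "open \<Omega>"
    and "continuous_on (\<Omega> \<times> UNIV) (\<lambda>(x, s). f x s)"
    and "continuous_on UNIV g"
    and "\<exists>s0\<ge>0. (\<forall>s\<ge>s0. g s \<ge> 0) \<and> (\<forall>s\<le>-s0. g s \<le> 0)"
    and "continuous_on (\<Omega> \<times> UNIV \<times> sym_mats) (\<lambda>(x, p, X). M x p X)"
    and "has_entry_partials \<Omega> M"
    and N_def: "N = natural_gradient_term M"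
    and "\<And>x p X l. x \<in> \<Omega> \<Longrightarrow> X \<in> sym_mats \<Longrightarrow> l \<noteq> 0 \<Longrightarrow>
           M x (l *\<^sub>R p) X = \<bar>l\<bar> powr \<alpha> * M x p X"
    and "\<And>x p X \<gamma> \<sigma>. x \<in> \<Omega> \<Longrightarrow> X \<in> sym_mats \<Longrightarrow> \<gamma> \<noteq> 0 \<Longrightarrow>
           M x p (\<gamma> *\<^sub>R X + \<sigma> *\<^sub>R outer p p) = \<gamma> ^ (\<beta> + 1) * M x p X + \<sigma> * \<gamma> ^ \<beta> * N x p X"
    and h_def: "h = (\<lambda>x s. exp ((\<alpha> + real \<beta> + 1) * prim g (inv (Phi g) s)) * f x (inv (Phi g) s))"
  shows "(\<forall>v. viscosity_solution \<Omega> (\<lambda>x w p X. M x p X + h x w) v \<longrightarrow>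
              viscosity_solution \<Omega> (\<lambda>x w p X. M x p X + g w * N x p X + f x w)
                (\<lambda>x. inv (Phi g) (v x)))
       \<and> (\<forall>u. viscosity_solution \<Omega> (\<lambda>x w p X. M x p X + g w * N x p X + f x w) u \<longrightarrow>
              viscosity_solution \<Omega> (\<lambda>x w p X. M x p X + h x w) (\<lambda>x. Phi g (u x)))"
proof -
  let ?P = "Phi g" and ?Q = "inv (Phi g)" and ?G = "prim g"
  let ?A = "\<lambda>x w p X. M x p X + g w * N x p X + f x w"
  let ?B = "\<lambda>x w p X. M x p X + h x w"
  note hom = assms(8) and shift = assms(9)
  obtain m where m: "\<And>s. m \<le> ?G s"
    using prim_bounded_below[OF assms(3)] assms(4) by metis
  have smono: "strict_mono ?P" and surj: "surj ?P"
    using strict_mono_Phi surj_Phi assms(3) m by blast+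
  have QP [simp]: "?Q (?P s) = s" for s
    using smono by (simp add: strict_mono_imp_inj_on)
  have PQ [simp]: "?P (?Q s) = s" for s
    using surj by (rule surj_f_inv_f)
  have monoP: "mono ?P" using smono by (rule strict_mono_mono)
  have monoQ: "mono ?Q"
    using smono by (intro monoI) (metis PQ strict_mono_less_eq)
  have P: "(?P has_real_derivative exp (?G t)) (at t)" for t
    using assms(3) by (rule Phi_has_real_derivative)
  have G: "(?G has_real_derivative g t) (at t)" for t
    using assms(3) by (rule prim_has_real_derivative)
  have P': "((\<lambda>t. exp (?G t)) has_real_derivative exp (?G t) * g t) (at t)" for t
    by (auto intro!: derivative_eq_intros G)
  have P'': "continuous_on UNIV (\<lambda>t. exp (?G t) * g t)"
    by (intro continuous_intros continuous_on_prim assms(3))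
  have cQ: "isCont ?Q t" for t
    using smono surj by (rule isCont_inv_strict_mono)
  have contQ: "continuous_on UNIV ?Q"
    using cQ by (simp add: continuous_on_eq_continuous_at)
  have Q: "(?Q has_real_derivative exp (- ?G (?Q t))) (at t)" for t
    using has_field_derivative_inverse_basic[OF P, of ?Q t UNIV] cQ
    by (simp add: exp_minus)
  \<comment> \<open>Differentiating \<open>- ?G (?Q t)\<close> gives the factor
    \<open>- g (?Q t)\<close> times the derivative of \<open>?Q\<close>, which is the exponential
    once more; hence the square.\<close>
  have Q': "((\<lambda>t. exp (- ?G (?Q t))) has_real_derivative
      - g (?Q t) * (exp (- ?G (?Q t)))\<^sup>2) (at t)" for t
    by (auto intro!: derivative_eq_intros DERIV_chain2[OF G] Q simp: power2_eq_square)
  have Q'': "continuous_on UNIV (\<lambda>t. - g (?Q t) * (exp (- ?G (?Q t)))\<^sup>2)"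
    by (intro continuous_intros contQ continuous_on_compose2[OF assms(3) contQ]
        continuous_on_compose2[OF continuous_on_prim[OF assms(3)] contQ]) auto
  have relP: "?B x (?P s) (exp (?G s) *\<^sub>R p) (exp (?G s) *\<^sub>R X + (exp (?G s) * g s) *\<^sub>R outer p p)
      = exp ((\<alpha> + real \<beta> + 1) * ?G s) * ?A x s p X"
    if "x \<in> \<Omega>" "X \<in> sym_mats" for x s p X
  proof -
    let ?E = "exp (?G s)"
    have "M x (?E *\<^sub>R p) (?E *\<^sub>R X + (?E * g s) *\<^sub>R outer p p)
        = ?E powr \<alpha> * (?E ^ (\<beta> + 1) * M x p X + ?E * g s * ?E ^ \<beta> * N x p X)"
      \<comment> \<open>\<open>hom\<close> is applied at the shifted matrix, which must therefore be
        symmetric; \<open>shift\<close> then expands that matrix.\<close>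
      using that by (simp add: hom shift sym_mats_combine del: power_Suc power_add)
    also have "\<dots> = ?E powr \<alpha> * ?E ^ (\<beta> + 1) * (M x p X + g s * N x p X)"
      by (simp add: algebra_simps)
    also have "?E powr \<alpha> * ?E ^ (\<beta> + 1) = exp ((\<alpha> + real \<beta> + 1) * ?G s)"
      by (simp add: powr_def algebra_simps exp_add exp_of_nat_mult)
    \<comment> \<open>The weight in \<open>h\<close> is this same exponential:
      \<open>h x (?P s)\<close> is
      \<open>exp ((\<alpha> + real \<beta> + 1) * ?G s) * f x s\<close>, so the factor comes out of
      all three terms.\<close>
    finally show ?thesis
      by (simp add: h_def algebra_simps)
  qed
  \<comment> \<open>\<open>relP\<close> at the pair \<open>(q, Y)\<close> that the change of variable \<open>?P\<close> sends to \<open>(p, X)\<close>; the term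
    \<open>N x q Y\<close> is thus never expanded.\<close>
  have relQ: "?A x (?Q s) (exp (- ?G (?Q s)) *\<^sub>R p)
      (exp (- ?G (?Q s)) *\<^sub>R X + (- g (?Q s) * (exp (- ?G (?Q s)))\<^sup>2) *\<^sub>R outer p p)
      = exp (- (\<alpha> + real \<beta> + 1) * ?G (?Q s)) * ?B x s p X"
    if "x \<in> \<Omega>" "X \<in> sym_mats" for x s p X
  proof -
    define E where "E = exp (?G (?Q s))"
    have E: "E > 0" "exp (- ?G (?Q s)) = 1 / E"
      by (simp_all add: E_def exp_minus inverse_eq_divide)
    define K where "K = exp ((\<alpha> + real \<beta> + 1) * ?G (?Q s))"
    have K: "K > 0" "exp (- (\<alpha> + real \<beta> + 1) * ?G (?Q s)) = 1 / K"
      unfolding K_def mult_minus_left by (simp_all only: exp_gt_zero exp_minus inverse_eq_divide)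
    define q where "q = (1 / E) *\<^sub>R p"
    define Y where "Y = (1 / E) *\<^sub>R X + (- g (?Q s) * (1 / E)\<^sup>2) *\<^sub>R outer p p"
    have q: "E *\<^sub>R q = p"
      using E by (simp add: q_def)
    \<comment> \<open>The rank-one terms cancel: \<open>E *\<^sub>R Y\<close> contributes the
      coefficient \<open>- g (?Q s) / E\<close> of \<open>outer p p\<close>, and
      \<open>outer q q\<close> is \<open>outer p p\<close> divided by the square of
      \<open>E\<close>.\<close>
    have Y: "E *\<^sub>R Y + (E * g (?Q s)) *\<^sub>R outer q q = X"
      using E by (simp add: Y_def q_def outer_scaleR scaleR_diff_right power2_eq_square)
    have "Y \<in> sym_mats"
      unfolding Y_def using that by (intro sym_mats_combine)
    from relP[OF that(1) this, of "?Q s" q]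
    have "?B x s p X = K * ?A x (?Q s) q Y"
      by (simp only: E_def[symmetric] K_def[symmetric] q Y PQ)
    then have "?A x (?Q s) q Y = 1 / K * ?B x s p X"
      using K(1) by simp
    then show ?thesis
      unfolding E(2) K(2) q_def Y_def .
  qed
  have "viscosity_solution \<Omega> ?A (\<lambda>x. ?Q (v x))" if v: "viscosity_solution \<Omega> ?B v" for v
  \<comment> \<open>The change of variable takes the known solution as \<open>F\<close> of the new
    one. Here \<open>v\<close> is \<open>?P\<close> of \<open>?Q (v x)\<close>, so test functions
    for the solution of (A) are composed with \<open>?P\<close>; the converse composes with
    \<open>?Q\<close>.\<close>
  proof (rule viscosity_solution_change_of_variable[OF assms(1) monoP P P' P'', where \<G> = ?B])
    show "\<exists>c>0. ?B x (?P s) (exp (?G s) *\<^sub>R p) (exp (?G s) *\<^sub>R X + (exp (?G s) * g s) *\<^sub>R outer p p)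
        = c * ?A x s p X" if "x \<in> \<Omega>" "X \<in> sym_mats" for x s p X
      using relP[OF that] by (metis exp_gt_zero)
    have "continuous_on \<Omega> v"
      using v by (simp add: viscosity_solution_def viscosity_subsolution_def)
    then show "continuous_on \<Omega> (\<lambda>x. ?Q (v x))"
      by (rule continuous_on_compose2[OF contQ]) simp
  qed (use v in simp)
  moreover have "viscosity_solution \<Omega> ?B (\<lambda>x. ?P (u x))" if u: "viscosity_solution \<Omega> ?A u" for u
  proof (rule viscosity_solution_change_of_variable[OF assms(1) monoQ Q Q' Q'', where \<G> = ?A])
    show "\<exists>c>0. ?A x (?Q s) (exp (- ?G (?Q s)) *\<^sub>R p)
        (exp (- ?G (?Q s)) *\<^sub>R X + (- g (?Q s) * (exp (- ?G (?Q s)))\<^sup>2) *\<^sub>R outer p p)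
        = c * ?B x s p X" if "x \<in> \<Omega>" "X \<in> sym_mats" for x s p X
      using relQ[OF that] by (metis exp_gt_zero)
    have "continuous_on \<Omega> u"
      using u by (simp add: viscosity_solution_def viscosity_subsolution_def)
    then show "continuous_on \<Omega> (\<lambda>x. ?P (u x))"
      by (rule continuous_on_compose2[OF continuous_on_Phi[OF assms(3)]]) simp
  qed (use u in simp)
  ultimately show ?thesis
    by blast
qed

end
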